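(* Let $\mathbf{m}=(m_1,\ldots,m_k)\in\mathbb{N}^k$ and let $\phi=(\phi_1,\ldots,\phi_k)$ be a $k$-tuple of positive linear maps on $B(\mathcal{H})$ such that each $\phi_i$ is pure. Then $\mathbf{\Delta}_\phi^{\mathbf{m}}:=(id-\phi_1)^{m_1}\circ\cdots\circ(id-\phi_k)^{m_k}$ is a one-to-one map and each $X\in B(\mathcal{H})$ has the representation $$X=\Lambda_k^{[m_k]}\left(\cdots\left(\Lambda_1^{[m_1]}(\mathbf{\Delta}_\phi^{\mathbf{m}}(X))\right)\right),$$ where the iterated series converge in the weak operator topology. If, in addition, $\mathbf{\Delta}_\phi^{\mathbf{m}}(X)\geq 0$, then $$X=\sum_{(s_1,\ldots,s_k)\in\mathbb{Z}_+^k}\binom{s_1+m_1-1}{m_1-1}\cdots\binom{s_k+m_k-1}{m_k-1}\,\phi_1^{s_1}\circ\cdots\circ\phi_k^{s_k}(\mathbf{\Delta}_\phi^{\mathbf{m}}(X)),$$ where the convergence of the series is in the weak operator topology.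
   Context: $B(\mathcal{H})$ is the algebra of bounded linear operators on a separable Hilbert space $\mathcal{H}$. $\mathbb{N}=\{1,2,\ldots\}$, $\mathbb{Z}_+=\{0,1,2,\ldots\}$; $id$ is the identity map on $B(\mathcal{H})$; powers of linear maps on $B(\mathcal{H})$ are iterates under composition ($\varphi^0=id$). A linear map $\varphi$ on $B(\mathcal{H})$ is positive if it maps positive operators to positive operators. A positive linear map $\varphi$ on $B(\mathcal{H})$ is called pure if $\varphi^p(I)\to 0$ weakly (in the weak operator topology) as $p\to\infty$. For $i\in\{1,\ldots,k\}$ define $\Lambda_i^{[1]}(Y):=\sum_{s=0}^\infty\phi_i^{s}(Y)$ and, for $p\ge 2$, $\Lambda_i^{[p]}(Y):=\sum_{s=0}^\infty\phi_i^{s}(\Lambda_i^{[p-1]}(Y))$, for those $Y\in B(\mathcal{H})$ for which all the series converge in the weak operator topology.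
   Formalization: The final multiple-series formula is stated under the additional assumption that the maps φ_1,…,φ_k commute pairwise; without it the formula fails, e.g. on 2×2 matrices with φ_1(X)=E_12 X E_21, φ_2(X)=E_21 X E_12 and X=I. *)

theory Defs
  imports "HOL-Analysis.Analysis"
begin

section \<open>Complex Hilbert spaces\<close>

class complex_vector = real_vector +
  fixes scaleC :: "complex \<Rightarrow> 'a \<Rightarrow> 'a"  (infixr \<open>*\<^sub>C\<close> 75)
  assumes scaleC_add_right: "c *\<^sub>C (x + y) = c *\<^sub>C x + c *\<^sub>C y"
    and scaleC_add_left: "(c + d) *\<^sub>C x = c *\<^sub>C x + d *\<^sub>C x"
    and scaleC_scaleC: "c *\<^sub>C d *\<^sub>C x = (c * d) *\<^sub>C x"
    and scaleC_one: "1 *\<^sub>C x = x"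
    and scaleR_scaleC: "r *\<^sub>R x = complex_of_real r *\<^sub>C x"

text \<open>The inner product is linear in the first argument. Completeness comes from the library class
  \<^class>\<open>banach\<close>, whose norm is required to be the one induced by the inner product.\<close>

class complex_hilbert = complex_vector + banach +
  fixes cinner :: "'a \<Rightarrow> 'a \<Rightarrow> complex"
  assumes cinner_add_left: "cinner (x + y) z = cinner x z + cinner y z"
    and cinner_scaleC_left: "cinner (c *\<^sub>C x) y = c * cinner x y"
    and cinner_commute: "cinner x y = cnj (cinner y x)"
    and cinner_self_norm: "cinner x x = complex_of_real ((norm x)\<^sup>2)"

definition separable :: "'a::topological_space itself \<Rightarrow> bool" where
  "separable _ \<longleftrightarrow> (\<exists>D::'a set. countable D \<and> closure D = UNIV)"

section \<open>Bounded operators\<close>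

typedef (overloaded) 'a bop =
  "{T :: 'a::complex_hilbert \<Rightarrow> 'a. bounded_linear T \<and> (\<forall>c x. T (c *\<^sub>C x) = c *\<^sub>C T x)}"
  morphisms bop_apply Bop
proof -
  have "bounded_linear (\<lambda>x::'a. x)"
    by (rule bounded_linear_ident)
  then show ?thesis by blast
qed

setup_lifting type_definition_bop

lemma norm_scaleC: "norm (c *\<^sub>C x) = cmod c * norm (x :: 'a::complex_hilbert)"
proof -
  have "cinner (c *\<^sub>C x) (c *\<^sub>C x) = c * cnj c * cinner x x"
    by (metis cinner_commute cinner_scaleC_left complex_cnj_mult mult.assoc)
  then have "complex_of_real ((norm (c *\<^sub>C x))\<^sup>2) = complex_of_real ((cmod c * norm x)\<^sup>2)"
    by (simp add: cinner_self_norm complex_norm_square power_mult_distrib flip: of_real_power)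
  then have "(norm (c *\<^sub>C x))\<^sup>2 = (cmod c * norm x)\<^sup>2"
    using of_real_eq_iff by blast
  then show ?thesis
    by (simp add: power2_eq_iff_nonneg)
qed

lemma bounded_linear_scaleC: "bounded_linear (\<lambda>x::'a::complex_hilbert. c *\<^sub>C x)"
  by (rule bounded_linear_intro[where K = "cmod c"])
     (simp_all add: scaleC_add_right scaleR_scaleC scaleC_scaleC norm_scaleC mult.commute)

lemma scaleC_zero_right [simp]: "c *\<^sub>C (0 :: 'a::complex_vector) = 0"
  using scaleC_add_right[of c 0 "0::'a"] by simp

lemma scaleC_minus_right: "c *\<^sub>C (- x :: 'a::complex_vector) = - (c *\<^sub>C x)"
  using scaleC_add_right[of c x "- x"] by (simp add: eq_neg_iff_add_eq_0 add.commute)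

lemma scaleC_diff_right: "c *\<^sub>C (x - y :: 'a::complex_vector) = c *\<^sub>C x - c *\<^sub>C y"
  using scaleC_add_right[of c x "- y"] by (simp add: scaleC_minus_right)

instantiation bop :: (complex_hilbert) complex_vector
begin

lift_definition zero_bop :: "'a bop" is "\<lambda>_. 0"
  by simp

lift_definition plus_bop :: "'a bop \<Rightarrow> 'a bop \<Rightarrow> 'a bop" is "\<lambda>S T x. S x + T x"
  by (simp add: bounded_linear_add scaleC_add_right)

lift_definition minus_bop :: "'a bop \<Rightarrow> 'a bop \<Rightarrow> 'a bop" is "\<lambda>S T x. S x - T x"
  by (simp add: bounded_linear_sub scaleC_diff_right)

lift_definition uminus_bop :: "'a bop \<Rightarrow> 'a bop" is "\<lambda>T x. - T x"
  by (simp add: bounded_linear_minus scaleC_minus_right)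

lift_definition scaleC_bop :: "complex \<Rightarrow> 'a bop \<Rightarrow> 'a bop" is "\<lambda>c T x. c *\<^sub>C T x"
  by (auto simp: scaleC_scaleC mult.commute
           intro: bounded_linear_compose[OF bounded_linear_scaleC])

definition scaleR_bop :: "real \<Rightarrow> 'a bop \<Rightarrow> 'a bop" where
  "scaleR_bop r T = complex_of_real r *\<^sub>C T"

instance
proof
  fix r s :: real and c d :: complex and S T U :: "'a bop"
  show "S + T + U = S + (T + U)" by transfer (simp add: add.assoc)
  show "S + T = T + S" by transfer (simp add: add.commute)
  show "0 + T = T" by transfer simp
  show "- T + T = 0" by transfer simp
  show "S - T = S + - T" by transfer simp
  show 1: "c *\<^sub>C (S + T) = c *\<^sub>C S + c *\<^sub>C T" for c
    and S T :: "'a bop" by transfer (simp add: scaleC_add_right)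
  show 2: "(c + d) *\<^sub>C T = c *\<^sub>C T + d *\<^sub>C T" for c d
    and T :: "'a bop" by transfer (simp add: scaleC_add_left)
  show 3: "c *\<^sub>C d *\<^sub>C T = (c * d) *\<^sub>C T" for c d
    and T :: "'a bop" by transfer (simp add: scaleC_scaleC)
  show 4: "1 *\<^sub>C T = T" for T :: "'a bop" by transfer (simp add: scaleC_one)
  show "r *\<^sub>R T = complex_of_real r *\<^sub>C T" by (simp add: scaleR_bop_def)
  show "r *\<^sub>R (S + T) = r *\<^sub>R S + r *\<^sub>R T" by (simp add: scaleR_bop_def 1)
  show "(r + s) *\<^sub>R T = r *\<^sub>R T + s *\<^sub>R T" by (simp add: scaleR_bop_def 2)
  show "r *\<^sub>R s *\<^sub>R T = (r * s) *\<^sub>R T" by (simp add: scaleR_bop_def 3)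
  show "1 *\<^sub>R T = T" by (simp add: scaleR_bop_def 4)
qed

end

lift_definition id_bop :: "'a::complex_hilbert bop" is "\<lambda>x. x"
  by simp

definition positive_op :: "'a::complex_hilbert bop \<Rightarrow> bool" where
  "positive_op T \<longleftrightarrow> (\<forall>x. cinner (bop_apply T x) x \<in> \<real>\<^sub>\<ge>\<^sub>0)"

section \<open>Convergence in the weak operator topology\<close>

definition wot_tendsto :: "('b \<Rightarrow> 'a::complex_hilbert bop) \<Rightarrow> 'a bop \<Rightarrow> 'b filter \<Rightarrow> bool" where
  "wot_tendsto f T F \<longleftrightarrow>
     (\<forall>x y. ((\<lambda>b. cinner (bop_apply (f b) x) y) \<longlongrightarrow> cinner (bop_apply T x) y) F)"

definition wot_sums :: "(nat \<Rightarrow> 'a::complex_hilbert bop) \<Rightarrow> 'a bop \<Rightarrow> bool" where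
  "wot_sums f T \<longleftrightarrow> wot_tendsto (\<lambda>n. \<Sum>s<n. f s) T sequentially"

definition wot_summable :: "(nat \<Rightarrow> 'a::complex_hilbert bop) \<Rightarrow> bool" where
  "wot_summable f \<longleftrightarrow> (\<exists>T. wot_sums f T)"

definition wot_suminf :: "(nat \<Rightarrow> 'a::complex_hilbert bop) \<Rightarrow> 'a bop" where
  "wot_suminf f = (THE T. wot_sums f T)"

text \<open>For series over an unordered index set: the net of all finite partial sums converges.\<close>

definition wot_has_sum :: "('i \<Rightarrow> 'a::complex_hilbert bop) \<Rightarrow> 'a bop \<Rightarrow> 'i set \<Rightarrow> bool" where
  "wot_has_sum f T A \<longleftrightarrow> wot_tendsto (sum f) T (finite_subsets_at_top A)"

section \<open>Positive linear maps on the bounded operators\<close>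

definition positive_linear_map :: "('a::complex_hilbert bop \<Rightarrow> 'a bop) \<Rightarrow> bool" where
  "positive_linear_map \<phi> \<longleftrightarrow>
     Vector_Spaces.linear (*\<^sub>C) (*\<^sub>C) \<phi> \<and> (\<forall>T. positive_op T \<longrightarrow> positive_op (\<phi> T))"

definition pure_map :: "('a::complex_hilbert bop \<Rightarrow> 'a bop) \<Rightarrow> bool" where
  "pure_map \<phi> \<longleftrightarrow> wot_tendsto (\<lambda>p. (\<phi> ^^ p) id_bop) 0 sequentially"

text \<open>The partial map \<open>\<Lambda>\<^sup>[\<^sup>p\<^sup>]\<close> is given by its values \<open>Lambda \<phi> p\<close> and its domain, on which all series
  occurring in the recursion converge. The recursion is started at \<open>p = 0\<close> with the identity, so
  that \<open>p = 1\<close> gives the series of the iterates of \<open>\<phi>\<close>.\<close>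

primrec Lambda :: "('a::complex_hilbert bop \<Rightarrow> 'a bop) \<Rightarrow> nat \<Rightarrow> 'a bop \<Rightarrow> 'a bop" where
  "Lambda \<phi> 0 Y = Y"
| "Lambda \<phi> (Suc p) Y = wot_suminf (\<lambda>s. (\<phi> ^^ s) (Lambda \<phi> p Y))"

primrec Lambda_dom :: "('a::complex_hilbert bop \<Rightarrow> 'a bop) \<Rightarrow> nat \<Rightarrow> 'a bop \<Rightarrow> bool" where
  "Lambda_dom \<phi> 0 Y \<longleftrightarrow> True"
| "Lambda_dom \<phi> (Suc p) Y \<longleftrightarrow>
     Lambda_dom \<phi> p Y \<and> wot_summable (\<lambda>s. (\<phi> ^^ s) (Lambda \<phi> p Y))"

text \<open>Tuples are functions on \<open>{1..k}\<close>. Since \<open>foldr f [1..<Suc k] x = f 1 (\<dots> (f k x))\<close> and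
  \<open>fold f [1..<Suc k] x = f k (\<dots> (f 1 x))\<close>, the map with index \<open>k\<close> is applied first in \<open>Delta\<close> and
  \<open>comp_powers\<close>, and last in \<open>Lambda_iter\<close>. For maps that do not commute the order matters: on
  \<open>2 \<times> 2\<close> matrices, \<open>\<phi>\<^sub>1 X = E\<^sub>1\<^sub>2 X E\<^sub>2\<^sub>1\<close> and \<open>\<phi>\<^sub>2 X = E\<^sub>2\<^sub>1 X E\<^sub>1\<^sub>2\<close> are positive and pure with
  \<open>(id - \<phi>\<^sub>1) ((id - \<phi>\<^sub>2) I) = E\<^sub>1\<^sub>1\<close>, while the sum of all \<open>\<phi>\<^sub>1\<^sup>s (\<phi>\<^sub>2\<^sup>t E\<^sub>1\<^sub>1)\<close> is \<open>2 E\<^sub>1\<^sub>1 + E\<^sub>2\<^sub>2\<close>, not \<open>I\<close>.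
  Hence the expansion into a multiple series needs commuting maps, unlike the iterated one.\<close>

definition Delta ::
  "(nat \<Rightarrow> 'a::complex_hilbert bop \<Rightarrow> 'a bop) \<Rightarrow> (nat \<Rightarrow> nat) \<Rightarrow> nat \<Rightarrow> 'a bop \<Rightarrow> 'a bop" where
  "Delta \<phi> m k = foldr (\<lambda>i. (\<lambda>X. X - \<phi> i X) ^^ m i) [1..<Suc k]"

definition comp_powers ::
  "(nat \<Rightarrow> 'a::complex_hilbert bop \<Rightarrow> 'a bop) \<Rightarrow> (nat \<Rightarrow> nat) \<Rightarrow> nat \<Rightarrow> 'a bop \<Rightarrow> 'a bop" where
  "comp_powers \<phi> s k = foldr (\<lambda>i. \<phi> i ^^ s i) [1..<Suc k]"

definition Lambda_iter ::
  "(nat \<Rightarrow> 'a::complex_hilbert bop \<Rightarrow> 'a bop) \<Rightarrow> (nat \<Rightarrow> nat) \<Rightarrow> nat \<Rightarrow> 'a bop \<Rightarrow> 'a bop" where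
  "Lambda_iter \<phi> m k = fold (\<lambda>i. Lambda (\<phi> i) (m i)) [1..<Suc k]"

definition Lambda_iter_dom ::
  "(nat \<Rightarrow> 'a::complex_hilbert bop \<Rightarrow> 'a bop) \<Rightarrow> (nat \<Rightarrow> nat) \<Rightarrow> nat \<Rightarrow> 'a bop \<Rightarrow> bool" where
  "Lambda_iter_dom \<phi> m k Y \<longleftrightarrow>
     (\<forall>i<k. Lambda_dom (\<phi> (Suc i)) (m (Suc i)) (Lambda_iter \<phi> m i Y))"

end

(*
  If phi is positive and pure, then phi^n X tends weakly to 0 for every X: by positivity this reduces
  to phi^n I, as X is a combination of two self-adjoint operators, each lying between multiples of
  -I and I. Hence the sums of phi^s (X - phi X), s < n, telescope to X - phi^n X and converge to X,
  which inverts Delta one factor at a time. For commuting maps and Delta X >= 0, all the quadratic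
  forms in the expansion are nonnegative, so the iterated series may be rearranged.
*)
theory Submission
  imports Defs
begin

section \<open>Inner products, Riesz representation and adjoints\<close>

lemma cinner_add_right:
  "cinner x (y + z) = cinner x y + cinner x (z :: 'a::complex_hilbert)"
  using cinner_commute cinner_add_left by (metis complex_cnj_add)

lemma cinner_scaleC_right:
  "cinner x (c *\<^sub>C y) = cnj c * cinner x (y :: 'a::complex_hilbert)"
  using cinner_commute cinner_scaleC_left by (metis complex_cnj_mult)

lemma cinner_zero_left [simp]: "cinner 0 (y :: 'a::complex_hilbert) = 0"
  using cinner_add_left[of 0 0 y] by simp

lemma cinner_minus_left: "cinner (- x) y = - cinner x (y :: 'a::complex_hilbert)"
  using cinner_add_left[of x "- x" y] by (simp add: eq_neg_iff_add_eq_0 add.commute)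

lemma cinner_diff_left:
  "cinner (x - y) z = cinner x z - cinner y (z :: 'a::complex_hilbert)"
  using cinner_add_left[of x "- y" z] by (simp add: cinner_minus_left)

lemma cinner_minus_right: "cinner x (- y) = - cinner x (y :: 'a::complex_hilbert)"
  using cinner_commute cinner_minus_left by (metis complex_cnj_minus)

lemma cinner_diff_right:
  "cinner x (y - z) = cinner x y - cinner x (z :: 'a::complex_hilbert)"
  using cinner_add_right[of x y "- z"] by (simp add: cinner_minus_right)

lemma cinner_scaleR_left: "cinner (r *\<^sub>R x) y = of_real r * cinner x (y :: 'a::complex_hilbert)"
  by (simp add: scaleR_scaleC cinner_scaleC_left)

lemma norm_add_sq:
  "(norm (x + y))\<^sup>2 = (norm x)\<^sup>2 + 2 * Re (cinner x y) + (norm (y :: 'a::complex_hilbert))\<^sup>2"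
proof -
  have "complex_of_real ((norm (x + y))\<^sup>2) = cinner (x + y) (x + y)"
    by (simp add: cinner_self_norm)
  also have "\<dots> = cinner x x + cinner x y + cnj (cinner x y) + cinner y y"
    by (simp add: cinner_add_left cinner_add_right flip: cinner_commute)
  finally have "Re (complex_of_real ((norm (x + y))\<^sup>2))
      = Re (cinner x x + cinner x y + cnj (cinner x y) + cinner y y)"
    by (rule arg_cong)
  then show ?thesis
    by (simp add: cinner_self_norm)
qed

lemma Re_cinner_le: "Re (cinner x y) \<le> norm x * norm (y :: 'a::complex_hilbert)"
proof -
  have "(norm (x + y))\<^sup>2 \<le> (norm x + norm y)\<^sup>2"
    by (simp add: norm_triangle_ineq power_mono)
  then show ?thesis
    by (simp add: norm_add_sq power2_sum)
qed

lemma abs_Re_cinner_le: "\<bar>Re (cinner x y)\<bar> \<le> norm x * norm (y :: 'a::complex_hilbert)"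
  using Re_cinner_le[of x y] Re_cinner_le[of "- x" y] by (simp add: cinner_minus_left)

lemma cinner_left_ext:
  assumes "\<And>x. cinner x y = cinner x (z :: 'a::complex_hilbert)"
  shows "y = z"
proof -
  have "cinner (y - z) (y - z) = 0"
    using assms[of "y - z"] by (simp add: cinner_diff_right)
  then show ?thesis
    by (simp add: cinner_self_norm)
qed

text \<open>Near 0 the linear term dominates the quadratic one. This is the first-order condition
  for the minimiser in the Riesz argument.\<close>

lemma quadratic_nonneg_imp_zero:
  fixes a b :: real
  assumes "\<And>t. 0 \<le> t\<^sup>2 * a + 2 * t * b"
  shows "b = 0"
proof (rule ccontr)
  assume b: "b \<noteq> 0"
  \<comment> \<open>At \<open>t = - b / d\<close> the quadratic equals
    \<open>(b / d)\<^sup>2 * (a - 2 * d)\<close>, so any positive \<open>d > a / 2\<close> gives a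
    negative value.\<close>
  obtain d where d: "d > 0" "a < 2 * d"
    by (rule that[of "1 + \<bar>a\<bar>"]) auto
  define s where "s = - b / d"
  have "s\<^sup>2 * a + 2 * s * b = (b / d)\<^sup>2 * (a - 2 * d)"
    using d by (simp add: s_def field_simps power2_eq_square)
  also have "\<dots> < 0"
    using b d by (intro mult_pos_neg) auto
  finally show False
    using assms[of s] by simp
qed

text \<open>The representing vector is the minimiser of \<open>\<parallel>z\<parallel>\<^sup>2 - 2 Re f(z)\<close>; minimising sequences are
  Cauchy by the parallelogram law.\<close>

lemma riesz_real:
  fixes f :: "'a::complex_hilbert \<Rightarrow> real"
  assumes "bounded_linear f"
  shows "\<exists>z. \<forall>x. f x = Re (cinner x z)"
proof -
  interpret f: bounded_linear f by fact
  obtain K where K: "\<And>x. \<bar>f x\<bar> \<le> norm x * K"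
    using f.bounded by (auto simp: real_norm_def)
  define J where "J z = (norm z)\<^sup>2 - 2 * f z" for z
  \<comment> \<open>Completing the square in \<open>norm z\<close>, after bounding
    \<open>f z\<close> by \<open>norm z * K\<close>.\<close>
  have J_ge: "J z \<ge> - K\<^sup>2" for z
  proof -
    have "0 \<le> (norm z - K)\<^sup>2" by simp
    then show ?thesis
      using K[of z] by (simp add: J_def power2_diff abs_le_iff algebra_simps)
  qed
  have bdd: "bdd_below (range J)"
    using J_ge by (rule bdd_belowI2)
  define d where "d = Inf (range J)"
  have d_le: "d \<le> J z" for z
    unfolding d_def using bdd by (simp add: cInf_lower)
  have "\<exists>z. J z < d + 1 / real (Suc n)" for n
    using cInf_lessD[of "range J" "d + 1 / real (Suc n)"] by (auto simp: d_def)
  then obtain u where u: "\<And>n. J (u n) < d + 1 / real (Suc n)"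
    by metis
  \<comment> \<open>In the parallelogram law, the term with \<open>v + w\<close> is controlled by
    \<open>d \<le> J\<close> at the midpoint of \<open>v\<close> and \<open>w\<close>.\<close>
  have para: "(norm (v - w))\<^sup>2 \<le> 2 * (J v - d) + 2 * (J w - d)" for v w
  proof -
    have "(norm (v + w))\<^sup>2 + (norm (v - w))\<^sup>2 = 2 * (norm v)\<^sup>2 + 2 * (norm w)\<^sup>2"
      using norm_add_sq[of v w] norm_add_sq[of v "- w"] by (simp add: cinner_minus_right)
    moreover have "J ((1/2) *\<^sub>R (v + w)) = (norm (v + w))\<^sup>2 / 4 - (f v + f w)"
      by (simp add: J_def f.scaleR f.add power_divide) (simp add: field_simps)
    ultimately show ?thesis
      using d_le[of "(1/2) *\<^sub>R (v + w)"] by (simp add: J_def)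
  qed
  have "Cauchy u"
  proof (rule metric_CauchyI)
    fix e :: real assume e: "e > 0"
    obtain N where N: "4 / e\<^sup>2 < real (Suc N)"
      using reals_Archimedean2 less_Suc_eq by (metis lessI less_trans of_nat_less_iff)
    have small: "J (u n) - d < e\<^sup>2 / 4" if "n \<ge> N" for n
    proof -
      have "1 / real (Suc n) \<le> 1 / real (Suc N)"
        using that by (simp add: frac_le)
      also have "\<dots> < e\<^sup>2 / 4"
        using N e by (simp add: field_simps)
      finally show ?thesis using u[of n] by simp
    qed
    have "dist (u i) (u j) < e" if "i \<ge> N" "j \<ge> N" for i j
    proof -
      have "(norm (u i - u j))\<^sup>2 < e\<^sup>2"
        using para[of "u i" "u j"] small[OF that(1)] small[OF that(2)] by simp
      then show ?thesis
        using e by (simp add: dist_norm power_less_imp_less_base)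
    qed
    then show "\<exists>M. \<forall>i\<ge>M. \<forall>j\<ge>M. dist (u i) (u j) < e"
      by blast
  qed
  then obtain z where z: "u \<longlonglongrightarrow> z"
    using Cauchy_convergent convergent_def by blast
  have "(\<lambda>n. J (u n)) \<longlonglongrightarrow> J z"
    unfolding J_def by (intro tendsto_intros f.tendsto z)
  moreover have "(\<lambda>n. d + 1 / real (Suc n)) \<longlonglongrightarrow> d + 0"
    by (intro tendsto_intros LIMSEQ_Suc[OF lim_1_over_n])
  ultimately have "J z \<le> d + 0"
    by (rule LIMSEQ_le) (use u less_imp_le in blast)
  then have min: "J z \<le> J y" for y
    using d_le[of y] by simp
  \<comment> \<open>Perturbing the minimiser \<open>z\<close> by \<open>t *\<^sub>R x\<close>
    changes \<open>J\<close> by a quadratic in \<open>t\<close> whose linear coefficient is twice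
    this difference.\<close>
  have "Re (cinner x z) - f x = 0" for x
  proof (rule quadratic_nonneg_imp_zero)
    fix t :: real
    have "J z \<le> J (t *\<^sub>R x + z)" by (rule min)
    then show "0 \<le> t\<^sup>2 * (norm x)\<^sup>2 + 2 * t * (Re (cinner x z) - f x)"
      unfolding J_def norm_add_sq f.add f.scaleR cinner_scaleR_left
      by (simp add: power_mult_distrib algebra_simps)
  qed
  then show ?thesis
    by (metis eq_iff_diff_eq_0)
qed

section \<open>Bounded operators and existence of adjoints\<close>

lemma bop_bounded_linear: "bounded_linear (bop_apply T)"
  using bop_apply[of T] by simp

lemma bop_apply_scaleC: "bop_apply T (c *\<^sub>C x) = c *\<^sub>C bop_apply T x"
  using bop_apply[of T] by simp

lemma bop_apply_add: "bop_apply T (x + y) = bop_apply T x + bop_apply T y"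
  by (rule linear_add) (rule bounded_linear.linear[OF bop_bounded_linear])

lemma bop_apply_diff: "bop_apply T (x - y) = bop_apply T x - bop_apply T y"
  by (rule linear_diff) (rule bounded_linear.linear[OF bop_bounded_linear])

lemma adjoint_exists: "\<exists>S. \<forall>x y. cinner (bop_apply T x) y = cinner x (bop_apply S y)"
proof -
  interpret T: bounded_linear "bop_apply T" by (rule bop_bounded_linear)
  obtain K where K: "K \<ge> 0" "\<And>x. norm (bop_apply T x) \<le> norm x * K"
    using T.nonneg_bounded by blast
  have "\<exists>z. \<forall>x. cinner (bop_apply T x) y = cinner x z" for y
  proof -
    have "bounded_linear (\<lambda>x. Re (cinner (bop_apply T x) y))"
    proof (rule bounded_linear_intro)
      fix x
      have "norm (bop_apply T x) * norm y \<le> norm x * K * norm y"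
        by (simp add: K(2) mult_right_mono)
      then show "norm (Re (cinner (bop_apply T x) y)) \<le> norm x * (K * norm y)"
        using abs_Re_cinner_le[of "bop_apply T x" y] by (simp add: mult.assoc)
    qed (simp_all add: T.add T.scaleR cinner_add_left cinner_scaleR_left)
    then obtain z where z: "\<And>x. Re (cinner (bop_apply T x) y) = Re (cinner x z)"
      using riesz_real by blast
    \<comment> \<open>Replacing \<open>x\<close> by \<open>\<i> *\<^sub>C x\<close> turns the
      imaginary part, up to sign, into a real part, so the real Riesz identity yields the complex
      one.\<close>
    have "cinner (bop_apply T x) y = cinner x z" for x
      using z[of x] z[of "\<i> *\<^sub>C x"]
      by (simp add: bop_apply_scaleC cinner_scaleC_left complex_eq_iff)
    then show ?thesis by blast
  qed
  then obtain S where S: "\<And>x y. cinner (bop_apply T x) y = cinner x (S y)"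
    by metis
  have add: "S (x + y) = S x + S y" for x y
    by (rule cinner_left_ext) (simp add: cinner_add_right flip: S)
  have scale: "S (c *\<^sub>C x) = c *\<^sub>C S x" for c x
    by (rule cinner_left_ext) (simp add: cinner_scaleC_right flip: S)
  have bound: "norm (S y) \<le> norm y * K" for y
  proof (cases "S y = 0")
    case False
    have "(norm (S y))\<^sup>2 = Re (cinner (bop_apply T (S y)) y)"
      by (simp add: S cinner_self_norm flip: of_real_power)
    also have "\<dots> \<le> norm (bop_apply T (S y)) * norm y"
      by (rule Re_cinner_le)
    also have "\<dots> \<le> norm (S y) * K * norm y"
      by (simp add: K(2) mult_right_mono)
    finally show ?thesis
      using False by (simp add: power2_eq_square mult.assoc mult.commute)
  qed (use K in simp)
  have "bounded_linear S"
    by (rule bounded_linear_intro[where K = K]) (simp_all add: add scale scaleR_scaleC bound)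
  then have "bop_apply (Bop S) = S"
    using scale by (simp add: Bop_inverse)
  then show ?thesis
    using S by metis
qed

section \<open>Quadratic forms and the weak operator topology\<close>

definition quad_form :: "'a::complex_hilbert bop \<Rightarrow> 'a \<Rightarrow> complex" where
  "quad_form T x = cinner (bop_apply T x) x"

lemma quad_form_zero [simp]: "quad_form 0 x = 0"
  by (simp add: quad_form_def zero_bop.rep_eq)

lemma quad_form_add [simp]: "quad_form (S + T) x = quad_form S x + quad_form T x"
  by (simp add: quad_form_def plus_bop.rep_eq cinner_add_left)

lemma quad_form_diff [simp]: "quad_form (S - T) x = quad_form S x - quad_form T x"
  by (simp add: quad_form_def minus_bop.rep_eq cinner_diff_left)

lemma quad_form_scaleC [simp]: "quad_form (c *\<^sub>C T) x = c * quad_form T x"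
  by (simp add: quad_form_def scaleC_bop.rep_eq cinner_scaleC_left)

lemma quad_form_sum: "quad_form (sum f A) x = (\<Sum>a\<in>A. quad_form (f a) x)"
  by (induction A rule: infinite_finite_induct) simp_all

lemma positive_op_iff: "positive_op T \<longleftrightarrow> (\<forall>x. quad_form T x \<in> \<real>\<^sub>\<ge>\<^sub>0)"
  by (simp add: positive_op_def quad_form_def)

text \<open>Quadratic forms thus determine all matrix coefficients, so equality of operators and
  weak convergence can be tested on them. The signs fit an inner product linear in its first
  argument.\<close>

lemma polarization:
  "cinner (bop_apply T x) y = (quad_form T (x + y) - quad_form T (x - y)
     + \<i> * quad_form T (x + \<i> *\<^sub>C y) - \<i> * quad_form T (x - \<i> *\<^sub>C y)) / 4"
  by (simp add: quad_form_def bop_apply_add bop_apply_diff bop_apply_scaleC cinner_add_left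
      cinner_add_right cinner_diff_left cinner_diff_right cinner_scaleC_left cinner_scaleC_right
      algebra_simps)

lemma wot_tendsto_iff_quad_form:
  "wot_tendsto f T F \<longleftrightarrow> (\<forall>x. ((\<lambda>b. quad_form (f b) x) \<longlongrightarrow> quad_form T x) F)"
proof
  assume "wot_tendsto f T F"
  then show "\<forall>x. ((\<lambda>b. quad_form (f b) x) \<longlongrightarrow> quad_form T x) F"
    by (simp add: wot_tendsto_def quad_form_def)
next
  assume "\<forall>x. ((\<lambda>b. quad_form (f b) x) \<longlongrightarrow> quad_form T x) F"
  then show "wot_tendsto f T F"
    unfolding wot_tendsto_def polarization by (intro allI tendsto_intros) auto
qed

lemma quad_form_ext:
  assumes "\<And>x. quad_form S x = quad_form T x"
  shows "S = T"
proof -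
  have "cinner y (bop_apply S x) = cinner y (bop_apply T x)" for x y
    using cinner_commute polarization assms by metis
  then have "bop_apply S = bop_apply T"
    using cinner_left_ext by blast
  then show ?thesis
    by (simp add: bop_apply_inject)
qed

text \<open>Scalar limits are unique and quadratic forms separate operators, so the definite
  description in \<open>wot_suminf\<close> has only one candidate.\<close>

lemma wot_suminf_eq:
  assumes "wot_sums f T"
  shows "wot_suminf f = T"
  unfolding wot_suminf_def
proof (rule the_equality)
  fix S assume "wot_sums f S"
  then show "S = T"
    using assms unfolding wot_sums_def wot_tendsto_iff_quad_form
    by (intro quad_form_ext) (meson LIMSEQ_unique)
qed (rule assms)

text \<open>The nonnegative reals form a closed subset of the complex plane.\<close>

lemma wot_limit_positive:
  assumes "wot_tendsto f T F" "F \<noteq> bot" "\<And>b. positive_op (f b)"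
  shows "positive_op T"
  unfolding positive_op_iff
proof
  fix x
  show "quad_form T x \<in> \<real>\<^sub>\<ge>\<^sub>0"
  proof (rule Lim_in_closed_set)
    show "((\<lambda>b. quad_form (f b) x) \<longlongrightarrow> quad_form T x) F"
      using assms(1) by (simp add: wot_tendsto_iff_quad_form)
  qed (use assms(2,3) in \<open>simp_all add: positive_op_iff\<close>)
qed

lemma positive_op_add: "positive_op S \<Longrightarrow> positive_op T \<Longrightarrow> positive_op (S + T)"
  by (simp add: positive_op_iff nonneg_Reals_add_I)

lemma positive_op_sum: "(\<And>a. a \<in> A \<Longrightarrow> positive_op (f a)) \<Longrightarrow> positive_op (sum f A)"
  by (induction A rule: infinite_finite_induct) (auto intro: positive_op_add simp: positive_op_iff)

text \<open>With \<open>S\<close> the adjoint of \<open>T\<close>, the parts are (T + S)/2 and (T -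
  S)/(2i). Self-adjointness is expressed by real quadratic forms.\<close>

lemma cartesian_decomposition:
  "\<exists>A B. T = A + \<i> *\<^sub>C B \<and> (\<forall>x. quad_form A x \<in> \<real>) \<and> (\<forall>x. quad_form B x \<in> \<real>)"
proof -
  obtain S where S: "\<And>x y. cinner (bop_apply T x) y = cinner x (bop_apply S y)"
    using adjoint_exists by blast
  have qS: "quad_form S x = cnj (quad_form T x)" for x
    unfolding quad_form_def using S cinner_commute by metis
  define A where "A = (1/2) *\<^sub>C (T + S)"
  define B where "B = (- \<i> / 2) *\<^sub>C (T - S)"
  have "T = A + \<i> *\<^sub>C B"
    by (rule quad_form_ext) (simp add: A_def B_def field_simps)
  moreover have "quad_form A x \<in> \<real>" "quad_form B x \<in> \<real>" for x
    by (simp_all add: A_def B_def qS complex_is_Real_iff)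
  ultimately show ?thesis
    by blast
qed

text \<open>Any norm bound \<open>K\<close> for \<open>A\<close> serves as \<open>c\<close>, by the
  Cauchy-Schwarz inequality.\<close>

lemma selfadjoint_le_scaled_id:
  assumes "\<And>x. quad_form A x \<in> \<real>"
  shows "\<exists>c. positive_op (complex_of_real c *\<^sub>C id_bop + A)
            \<and> positive_op (complex_of_real c *\<^sub>C id_bop - A)"
proof -
  obtain K where K: "\<And>x. norm (bop_apply A x) \<le> norm x * K"
    using bounded_linear.bounded[OF bop_bounded_linear] by blast
  have id: "quad_form id_bop x = of_real ((norm x)\<^sup>2)" for x :: 'a
    by (simp add: quad_form_def id_bop.rep_eq cinner_self_norm)
  have bound: "\<bar>Re (quad_form A x)\<bar> \<le> K * (norm x)\<^sup>2" for x
  proof -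
    have "\<bar>Re (quad_form A x)\<bar> \<le> norm (bop_apply A x) * norm x"
      unfolding quad_form_def by (rule abs_Re_cinner_le)
    also have "\<dots> \<le> norm x * K * norm x"
      by (simp add: K mult_right_mono)
    finally show ?thesis
      by (simp add: power2_eq_square mult.commute mult.left_commute)
  qed
  have "quad_form (complex_of_real K *\<^sub>C id_bop + A) x \<in> \<real>\<^sub>\<ge>\<^sub>0"
       "quad_form (complex_of_real K *\<^sub>C id_bop - A) x \<in> \<real>\<^sub>\<ge>\<^sub>0" for x
    using bound[of x] assms[of x]
    by (simp_all add: id complex_nonneg_Reals_iff complex_is_Real_iff abs_le_iff
        flip: of_real_mult of_real_power)
  then show ?thesis
    unfolding positive_op_iff by blast
qed

section \<open>Positive linear maps\<close>

lemma vector_space_scaleC: "vector_space ((*\<^sub>C) :: complex \<Rightarrow> 'a::complex_vector \<Rightarrow> 'a)"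
  by standard (simp_all add: scaleC_add_right scaleC_add_left scaleC_scaleC scaleC_one)

lemma positive_linear_map_iff:
  "positive_linear_map \<phi> \<longleftrightarrow> (\<forall>S T. \<phi> (S + T) = \<phi> S + \<phi> T) \<and> (\<forall>c T. \<phi> (c *\<^sub>C T) = c *\<^sub>C \<phi> T)
     \<and> (\<forall>T. positive_op T \<longrightarrow> positive_op (\<phi> T))"
  using vector_space_scaleC
  unfolding positive_linear_map_def Vector_Spaces.linear_def module_hom_def module_hom_axioms_def
    module_iff_vector_space by blast

lemma positive_linear_map_funpow:
  "positive_linear_map \<phi> \<Longrightarrow> positive_linear_map (\<phi> ^^ n)"
  by (induction n) (simp_all add: positive_linear_map_iff)

lemma positive_linear_map_diff:
  assumes "positive_linear_map \<phi>"
  shows "\<phi> (S - T) = \<phi> S - \<phi> T"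
proof -
  have "\<phi> (S - T) + \<phi> T = \<phi> (S - T + T)"
    using assms unfolding positive_linear_map_iff by metis
  then show ?thesis
    by (simp add: eq_diff_eq)
qed

lemma pure_map_iterates_tendsto:
  assumes \<phi>: "positive_linear_map \<phi>" "pure_map \<phi>"
  shows "wot_tendsto (\<lambda>p. (\<phi> ^^ p) X) 0 sequentially"
proof -
  have selfadj: "(\<lambda>p. quad_form ((\<phi> ^^ p) A) x) \<longlonglongrightarrow> 0"
    if real: "\<And>x. quad_form A x \<in> \<real>" for A x
  proof -
    obtain c where c: "positive_op (complex_of_real c *\<^sub>C id_bop + A)"
        "positive_op (complex_of_real c *\<^sub>C id_bop - A)"
      using selfadjoint_le_scaled_id[OF real] by blast
    \<comment> \<open>Positivity of \<open>\<phi> ^^ p\<close> squeezes the image of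
      \<open>A\<close> between multiples of the image of the identity. Both forms below being real
      forces the form of \<open>(\<phi> ^^ p) A\<close> to be real, so its modulus is the absolute
      value of its real part.\<close>
    have bound: "norm (quad_form ((\<phi> ^^ p) A) x) \<le> c * Re (quad_form ((\<phi> ^^ p) id_bop) x)" for p
    proof -
      note p = positive_linear_map_funpow[OF \<phi>(1), of p]
      have "positive_op ((\<phi> ^^ p) (complex_of_real c *\<^sub>C id_bop + A))"
           "positive_op ((\<phi> ^^ p) (complex_of_real c *\<^sub>C id_bop - A))"
        using p c unfolding positive_linear_map_iff by blast+
      moreover have "(\<phi> ^^ p) (c *\<^sub>C id_bop + A) = c *\<^sub>C (\<phi> ^^ p) id_bop + (\<phi> ^^ p) A"
                    "(\<phi> ^^ p) (c *\<^sub>C id_bop - A) = c *\<^sub>C (\<phi> ^^ p) id_bop - (\<phi> ^^ p) A"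
        using p by (simp_all add: positive_linear_map_iff positive_linear_map_diff)
      ultimately have
        "c * quad_form ((\<phi> ^^ p) id_bop) x + quad_form ((\<phi> ^^ p) A) x \<in> \<real>\<^sub>\<ge>\<^sub>0"
        "c * quad_form ((\<phi> ^^ p) id_bop) x - quad_form ((\<phi> ^^ p) A) x \<in> \<real>\<^sub>\<ge>\<^sub>0"
        by (simp_all add: positive_op_iff)
      then show ?thesis
        by (simp add: complex_nonneg_Reals_iff cmod_eq_Re abs_le_iff)
    qed
    have "(\<lambda>p. quad_form ((\<phi> ^^ p) id_bop) x) \<longlonglongrightarrow> 0"
      using \<phi>(2) by (simp add: pure_map_def wot_tendsto_iff_quad_form)
    then have "(\<lambda>p. c * Re (quad_form ((\<phi> ^^ p) id_bop) x)) \<longlonglongrightarrow> c * Re 0"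
      by (intro tendsto_intros)
    then have "(\<lambda>p. c * Re (quad_form ((\<phi> ^^ p) id_bop) x)) \<longlonglongrightarrow> 0"
      by simp
    with always_eventually[OF allI[OF bound]] show ?thesis
      by (rule Lim_null_comparison)
  qed
  obtain A B where X: "X = A + \<i> *\<^sub>C B"
      and AB: "\<And>x. quad_form A x \<in> \<real>" "\<And>x. quad_form B x \<in> \<real>"
    using cartesian_decomposition by blast
  have "(\<phi> ^^ p) X = (\<phi> ^^ p) A + \<i> *\<^sub>C (\<phi> ^^ p) B" for p
    using positive_linear_map_funpow[OF \<phi>(1), of p] by (simp add: X positive_linear_map_iff)
  moreover have "(\<lambda>p. quad_form ((\<phi> ^^ p) A) x + \<i> * quad_form ((\<phi> ^^ p) B) x) \<longlonglongrightarrow> 0 + \<i> * 0" for x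
    by (intro tendsto_intros selfadj AB)
  ultimately show ?thesis
    by (simp add: wot_tendsto_iff_quad_form)
qed

lemma wot_sums_telescope:
  assumes \<phi>: "positive_linear_map \<phi>" "pure_map \<phi>"
  shows "wot_sums (\<lambda>s. (\<phi> ^^ s) (X - \<phi> X)) X"
proof -
  have "(\<phi> ^^ s) (X - \<phi> X) = (\<phi> ^^ s) X - (\<phi> ^^ Suc s) X" for s
    using positive_linear_map_diff[OF positive_linear_map_funpow[OF \<phi>(1)]]
    by (simp add: funpow_swap1)
  then have "(\<Sum>s<n. (\<phi> ^^ s) (X - \<phi> X)) = X - (\<phi> ^^ n) X" for n
    using sum_lessThan_telescope'[of "\<lambda>s. (\<phi> ^^ s) X" n] by simp
  moreover have "(\<lambda>n. quad_form X x - quad_form ((\<phi> ^^ n) X) x) \<longlonglongrightarrow> quad_form X x - 0" for x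
    using pure_map_iterates_tendsto[OF \<phi>, of X]
    by (intro tendsto_intros) (simp add: wot_tendsto_iff_quad_form)
  ultimately show ?thesis
    by (simp add: wot_sums_def wot_tendsto_iff_quad_form)
qed

text \<open>Domain and value are proved together because the domain at \<open>Suc p\<close> refers
  to the value at \<open>p\<close>. The induction hypothesis at \<open>X - \<phi> X\<close>
  evaluates the first \<open>p\<close> series; the last one is then the telescoping series with sum
  \<open>X\<close>.\<close>

lemma Lambda_inverse:
  assumes "positive_linear_map \<phi>" "pure_map \<phi>"
  shows "Lambda_dom \<phi> p (((\<lambda>X. X - \<phi> X) ^^ p) X) \<and> Lambda \<phi> p (((\<lambda>X. X - \<phi> X) ^^ p) X) = X"
proof (induction p arbitrary: X)
  case (Suc p)
  have "wot_sums (\<lambda>s. (\<phi> ^^ s) (X - \<phi> X)) X"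
    by (rule wot_sums_telescope[OF assms])
  then show ?case
    using Suc[of "X - \<phi> X"] wot_suminf_eq
    by (auto simp: wot_summable_def funpow_Suc_right simp del: funpow.simps)
qed simp

section \<open>Expansion into series with positive terms\<close>

text \<open>The telescoping series exhibits \<open>X\<close> as a weak limit of sums of positive
  operators.\<close>

lemma positive_op_resolvent:
  assumes \<phi>: "positive_linear_map \<phi>" "pure_map \<phi>" and pos: "positive_op (X - \<phi> X)"
  shows "positive_op X"
proof (rule wot_limit_positive)
  show "wot_tendsto (\<lambda>n. \<Sum>s<n. (\<phi> ^^ s) (X - \<phi> X)) X sequentially"
    using wot_sums_telescope[OF \<phi>] by (simp add: wot_sums_def)
  show "positive_op (\<Sum>s<n. (\<phi> ^^ s) (X - \<phi> X))" for n
    using positive_linear_map_funpow[OF \<phi>(1)] pos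
    by (intro positive_op_sum) (simp add: positive_linear_map_iff)
qed simp

lemma positive_op_resolvent_funpow:
  assumes "positive_linear_map \<phi>" "pure_map \<phi>"
  shows "positive_op (((\<lambda>X. X - \<phi> X) ^^ p) X) \<Longrightarrow> positive_op X"
  by (induction p) (auto dest: positive_op_resolvent[OF assms])

lemma Re_quad_form_nonneg: "positive_op T \<Longrightarrow> 0 \<le> Re (quad_form T x)"
  by (simp add: positive_op_iff complex_nonneg_Reals_iff)

text \<open>The terms are nonnegative, so convergence of the ordered series upgrades to unordered
  summability, which permits the rearrangements below.\<close>

lemma has_sum_iterates:
  assumes \<phi>: "positive_linear_map \<phi>" "pure_map \<phi>" and pos: "positive_op (X - \<phi> X)"
  shows "((\<lambda>s. Re (quad_form ((\<phi> ^^ s) (X - \<phi> X)) x)) has_sum Re (quad_form X x)) UNIV"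
proof (rule sums_nonneg_imp_has_sum)
  show "0 \<le> Re (quad_form ((\<phi> ^^ s) (X - \<phi> X)) x)" for s
    using positive_linear_map_funpow[OF \<phi>(1), of s] pos
    by (intro Re_quad_form_nonneg) (simp add: positive_linear_map_iff)
  have "(\<lambda>n. Re (quad_form (\<Sum>s<n. (\<phi> ^^ s) (X - \<phi> X)) x)) \<longlonglongrightarrow> Re (quad_form X x)"
    using wot_sums_telescope[OF \<phi>, of X]
    by (intro tendsto_intros) (simp add: wot_sums_def wot_tendsto_iff_quad_form)
  then show "(\<lambda>s. Re (quad_form ((\<phi> ^^ s) (X - \<phi> X)) x)) sums Re (quad_form X x)"
    by (simp add: sums_def quad_form_sum)
qed

section \<open>Commutation with defects, and rearrangement of nonnegative sums\<close>

lemma funpow_commute: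
  assumes "\<And>X. f (g X) = g (f X)"
  shows "(f ^^ n) (g X) = g ((f ^^ n) X)"
  by (induction n) (simp_all add: assms)

lemma defect_commute:
  assumes "positive_linear_map \<psi>" "\<And>X. \<phi> (\<psi> X) = \<psi> (\<phi> X)"
  shows "((\<lambda>X. X - \<phi> X) ^^ n) (\<psi> X) = \<psi> (((\<lambda>X. X - \<phi> X) ^^ n) X)"
  by (rule funpow_commute) (simp add: assms(2) positive_linear_map_diff[OF assms(1)])

text \<open>Tonelli's theorem for sums: nonnegativity and summable row sums give joint summability,
  and the joint sum is then the iterated one.\<close>

lemma has_sum_Sigma_nonneg:
  fixes f :: "'a \<times> 'b \<Rightarrow> real"
  assumes "\<And>x. x \<in> A \<Longrightarrow> ((\<lambda>y. f (x, y)) has_sum g x) (B x)" "(g has_sum S) A"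
    and "\<And>x y. x \<in> A \<Longrightarrow> y \<in> B x \<Longrightarrow> 0 \<le> f (x, y)"
  shows "(f has_sum S) (Sigma A B)"
proof (rule has_sum_SigmaI)
  show "f summable_on Sigma A B"
    using assms by (intro summable_on_SigmaI[of A f B g]) (auto simp: summable_on_def)
qed (use assms in auto)

text \<open>The hockey-stick identity; it raises the order of the binomial coefficients by one in
  the next induction.\<close>

lemma sum_choose_diagonal: "(\<Sum>s\<le>n. (s + q) choose q) = (n + Suc q) choose Suc q"
  by (induction n) simp_all

text \<open>Positive maps need not be weakly continuous, so \<open>\<phi>\<^sup>t\<close> cannot be pulled into the series for
  \<open>X - \<phi> X\<close>. Instead the induction hypothesis is applied to each \<open>\<phi>\<^sup>t (X - \<phi> X)\<close>.\<close>

lemma has_sum_defect_power: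
  assumes \<phi>: "positive_linear_map \<phi>" "pure_map \<phi>"
    and pos: "positive_op (((\<lambda>X. X - \<phi> X) ^^ Suc q) X)"
  shows "((\<lambda>s. real ((s + q) choose q) * Re (quad_form ((\<phi> ^^ s) (((\<lambda>X. X - \<phi> X) ^^ Suc q) X)) x))
           has_sum Re (quad_form X x)) UNIV"
  using pos
proof (induction q arbitrary: X)
  case 0
  then show ?case
    using has_sum_iterates[OF \<phi>, of X x] by simp
next
  case (Suc q)
  define D where "D = (\<lambda>X. X - \<phi> X)"
  define Z where "Z = (D ^^ Suc (Suc q)) X"
  define a where "a n = Re (quad_form ((\<phi> ^^ n) Z) x)" for n
  have Z: "Z = (D ^^ Suc q) (X - \<phi> X)"
    by (simp add: Z_def funpow_Suc_right D_def del: funpow.simps)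
  have "positive_op Z"
    using Suc.prems by (simp add: Z_def D_def)
  then have pos_pow: "positive_op ((\<phi> ^^ t) Z)" for t
    using positive_linear_map_funpow[OF \<phi>(1)] by (simp add: positive_linear_map_iff)
  then have a_nonneg: "a n \<ge> 0" for n
    unfolding a_def by (rule Re_quad_form_nonneg)
  have comm: "(D ^^ Suc q) ((\<phi> ^^ t) (X - \<phi> X)) = (\<phi> ^^ t) Z" for t
    unfolding Z D_def
    by (rule defect_commute[OF positive_linear_map_funpow[OF \<phi>(1)]]) (rule funpow_swap1)
  have inner: "((\<lambda>s. real ((s + q) choose q) * a (s + t))
      has_sum Re (quad_form ((\<phi> ^^ t) (X - \<phi> X)) x)) UNIV" for t
    using Suc.IH[of "(\<phi> ^^ t) (X - \<phi> X)"] pos_pow[of t] comm[of t]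
    unfolding D_def[symmetric] by (simp add: a_def funpow_add del: funpow.simps)
  \<comment> \<open>Positivity descends from the full defect \<open>Z\<close> to the first-order
    one, as the outer expansion requires.\<close>
  have "positive_op (X - \<phi> X)"
    by (rule positive_op_resolvent_funpow[OF \<phi>, of "Suc q"])
       (use \<open>positive_op Z\<close> in \<open>simp only: Z D_def\<close>)
  \<comment> \<open>The outer sum over \<open>t\<close> expands \<open>X\<close> to first order; the
    inner sum over \<open>s\<close> expands each term to order \<open>Suc q\<close>.\<close>
  then have "((\<lambda>(t, s). real ((s + q) choose q) * a (s + t)) has_sum Re (quad_form X x))
      (UNIV \<times> UNIV)"
    using inner a_nonneg
    by (intro has_sum_Sigma_nonneg[OF _ has_sum_iterates[OF \<phi>]]) auto
  \<comment> \<open>Regrouping by \<open>n = s + t\<close>: the operator part depends on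
    \<open>n\<close> alone, and each \<open>n\<close> collects finitely many coefficients.\<close>
  also have "?this \<longleftrightarrow> ((\<lambda>(n, s). real ((s + q) choose q) * a n) has_sum Re (quad_form X x))
      (SIGMA n:UNIV. {..n})"
    by (rule has_sum_reindex_bij_witness[of _ "\<lambda>(n, s). (n - s, s)" "\<lambda>(t, s). (s + t, s)"]) auto
  finally have "((\<lambda>n. \<Sum>s\<le>n. real ((s + q) choose q) * a n) has_sum Re (quad_form X x)) UNIV"
    by (rule has_sum_Sigma') (auto intro: has_sum_finite)
  moreover have "(\<Sum>s\<le>n. real ((s + q) choose q) * a n) = real ((n + Suc q) choose Suc q) * a n" for n
    unfolding sum_choose_diagonal[symmetric] of_nat_sum sum_distrib_right ..
  ultimately show ?case
    by (simp add: a_def Z_def D_def del: binomial_Suc_Suc funpow.simps)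
qed

section \<open>Tuples of maps\<close>

lemma Delta_0 [simp]: "Delta \<phi> m 0 X = X"
  by (simp add: Delta_def)

lemma Delta_Suc:
  "Delta \<phi> m (Suc k) X = Delta \<phi> m k (((\<lambda>X. X - \<phi> (Suc k) X) ^^ m (Suc k)) X)"
  by (simp add: Delta_def)

lemma comp_powers_0 [simp]: "comp_powers \<phi> s 0 X = X"
  by (simp add: comp_powers_def)

lemma comp_powers_Suc:
  "comp_powers \<phi> s (Suc k) X = comp_powers \<phi> s k ((\<phi> (Suc k) ^^ s (Suc k)) X)"
  by (simp add: comp_powers_def)

lemma comp_powers_cong:
  "(\<And>i. i \<in> {1..k} \<Longrightarrow> s i = t i) \<Longrightarrow> comp_powers \<phi> s k X = comp_powers \<phi> t k X"
  by (induction k arbitrary: X) (simp_all add: comp_powers_Suc)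

lemma Lambda_iter_Suc:
  "Lambda_iter \<phi> m (Suc k) Y = Lambda (\<phi> (Suc k)) (m (Suc k)) (Lambda_iter \<phi> m k Y)"
  by (simp add: Lambda_iter_def)

text \<open>The factor with index \<open>Suc k\<close> acts first in \<open>Delta\<close> and is
  undone last in \<open>Lambda_iter\<close>: the induction hypothesis recovers the intermediate
  \<open>Z\<close>, and inverting the single factor recovers \<open>X\<close> from it.\<close>

lemma Lambda_iter_Delta:
  assumes "\<And>i. i \<in> {1..k} \<Longrightarrow> positive_linear_map (\<phi> i)" "\<And>i. i \<in> {1..k} \<Longrightarrow> pure_map (\<phi> i)"
  shows "Lambda_iter_dom \<phi> m k (Delta \<phi> m k X) \<and> Lambda_iter \<phi> m k (Delta \<phi> m k X) = X"
  using assms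
proof (induction k arbitrary: X)
  case 0
  then show ?case
    by (simp add: Lambda_iter_dom_def Lambda_iter_def)
next
  case (Suc k)
  define Z where "Z = ((\<lambda>X. X - \<phi> (Suc k) X) ^^ m (Suc k)) X"
  have "Lambda_dom (\<phi> (Suc k)) (m (Suc k)) Z \<and> Lambda (\<phi> (Suc k)) (m (Suc k)) Z = X"
    unfolding Z_def by (rule Lambda_inverse) (use Suc.prems in auto)
  moreover have "Lambda_iter_dom \<phi> m k (Delta \<phi> m k Z) \<and> Lambda_iter \<phi> m k (Delta \<phi> m k Z) = Z"
    using Suc by simp
  moreover have "Delta \<phi> m (Suc k) X = Delta \<phi> m k Z"
    by (simp add: Delta_Suc Z_def)
  ultimately show ?case
    by (auto simp: Lambda_iter_Suc Lambda_iter_dom_def less_Suc_eq)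
qed

lemma positive_op_comp_powers:
  assumes "\<And>i. i \<in> {1..k} \<Longrightarrow> positive_linear_map (\<phi> i)" "positive_op Y"
  shows "positive_op (comp_powers \<phi> s k Y)"
  using assms
proof (induction k arbitrary: Y)
  case (Suc k)
  have "positive_linear_map (\<phi> (Suc k) ^^ s (Suc k))"
    using Suc.prems by (intro positive_linear_map_funpow) simp
  then show ?case
    using Suc by (simp add: comp_powers_Suc positive_linear_map_iff)
qed simp

lemma Delta_commute:
  assumes "positive_linear_map \<psi>" "\<And>i X. i \<in> {1..k} \<Longrightarrow> \<phi> i (\<psi> X) = \<psi> (\<phi> i X)"
  shows "Delta \<phi> m k (\<psi> X) = \<psi> (Delta \<phi> m k X)"
  using assms(2)
proof (induction k arbitrary: X)
  case (Suc k)
  then show ?case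
    by (simp add: Delta_Suc defect_commute[OF assms(1)])
qed simp

text \<open>Each defect factor reflects positivity, so the composition does; the factor with the
  largest index is innermost and is removed last.\<close>

lemma positive_op_Delta_imp:
  assumes "\<And>i. i \<in> {1..k} \<Longrightarrow> positive_linear_map (\<phi> i)" "\<And>i. i \<in> {1..k} \<Longrightarrow> pure_map (\<phi> i)"
    and "positive_op (Delta \<phi> m k X)"
  shows "positive_op X"
  using assms
proof (induction k arbitrary: X)
  case (Suc k)
  have "positive_op (((\<lambda>X. X - \<phi> (Suc k) X) ^^ m (Suc k)) X)"
    by (rule Suc.IH) (use Suc.prems in \<open>auto simp: Delta_Suc\<close>)
  then show ?case
    by (rule positive_op_resolvent_funpow[rotated -1]) (use Suc.prems in auto)
qed simp

text \<open>Splits off the last coordinate of the multi-index. Resetting it to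
  \<open>undefined\<close> keeps the remaining tuple extensional, which makes the correspondence
  bijective.\<close>

lemma has_sum_PiE_Suc:
  fixes f :: "(nat \<Rightarrow> nat) \<Rightarrow> real"
  shows "(f has_sum S) ({1..Suc k} \<rightarrow>\<^sub>E UNIV) \<longleftrightarrow>
    ((\<lambda>(t, s). f (s(Suc k := t))) has_sum S) (UNIV \<times> ({1..k} \<rightarrow>\<^sub>E UNIV))"
  by (rule has_sum_reindex_bij_witness[of _ "\<lambda>(t, s). s(Suc k := t)"
        "\<lambda>s. (s (Suc k), s(Suc k := undefined))"])
     (auto simp: PiE_def extensional_def fun_eq_iff)

text \<open>Induction on the number of maps: the last map, \<open>\<psi>\<close>, is expanded in
  powers indexed by \<open>t\<close>, and the induction hypothesis expands every resulting
  \<open>(\<psi> ^^ t) Z\<close> in the other maps. Nonnegativity merges the two sums.\<close>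

lemma has_sum_comp_powers:
  assumes "\<And>i. i \<in> {1..k} \<Longrightarrow> m i \<ge> 1"
    and "\<And>i. i \<in> {1..k} \<Longrightarrow> positive_linear_map (\<phi> i)" "\<And>i. i \<in> {1..k} \<Longrightarrow> pure_map (\<phi> i)"
    and "\<And>i j X. i \<in> {1..k} \<Longrightarrow> j \<in> {1..k} \<Longrightarrow> \<phi> i (\<phi> j X) = \<phi> j (\<phi> i X)"
    and "positive_op (Delta \<phi> m k X)"
  shows "((\<lambda>s. real (\<Prod>i=1..k. (s i + m i - 1) choose (m i - 1))
            * Re (quad_form (comp_powers \<phi> s k (Delta \<phi> m k X)) x))
          has_sum Re (quad_form X x)) ({1..k} \<rightarrow>\<^sub>E UNIV)"
  using assms
proof (induction k arbitrary: X)
  case 0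
  then show ?case
    by (simp add: has_sum_finiteI)
next
  case (Suc k)
  define \<psi> where "\<psi> = \<phi> (Suc k)"
  define c where "c k s = real (\<Prod>i=1..k. (s i + m i - 1) choose (m i - 1))" for k and s :: "nat \<Rightarrow> nat"
  \<comment> \<open>Here \<open>m (Suc k) \<ge> 1\<close> enters: \<open>q\<close> is the lower
    index of the last binomial coefficient.\<close>
  obtain q where q: "m (Suc k) = Suc q"
    using Suc.prems(1)[of "Suc k"] by (cases "m (Suc k)") auto
  define Z where "Z = ((\<lambda>X. X - \<psi> X) ^^ Suc q) X"
  define Y where "Y = Delta \<phi> m k Z"
  have Y: "Delta \<phi> m (Suc k) X = Y"
    by (simp add: Y_def Delta_Suc Z_def q \<psi>_def)
  have \<psi>: "positive_linear_map \<psi>" "pure_map \<psi>"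
    using Suc.prems by (simp_all add: \<psi>_def)
  have "positive_op Y"
    using Suc.prems(5) Y by simp
  have pos: "positive_op ((\<psi> ^^ t) Y)" for t
    using \<open>positive_op Y\<close> positive_linear_map_funpow[OF \<psi>(1)] by (simp add: positive_linear_map_iff)
  have "positive_op Z"
    by (rule positive_op_Delta_imp[of k \<phi> m]) (use Suc.prems \<open>positive_op Y\<close> Y_def in auto)
  \<comment> \<open>Commutation brings the defect of \<open>(\<psi> ^^ t) Z\<close> into the
    positive form that the induction hypothesis demands.\<close>
  have comm: "Delta \<phi> m k ((\<psi> ^^ t) Z) = (\<psi> ^^ t) Y" for t
    unfolding Y_def
  proof (rule Delta_commute[OF positive_linear_map_funpow[OF \<psi>(1)]])
    fix i X assume "i \<in> {1..k}"
    then show "\<phi> i ((\<psi> ^^ t) X) = (\<psi> ^^ t) (\<phi> i X)"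
      using Suc.prems(4) by (intro funpow_commute[symmetric]) (simp add: \<psi>_def)
  qed
  have inner: "((\<lambda>s. c k s * Re (quad_form (comp_powers \<phi> s k ((\<psi> ^^ t) Y)) x))
      has_sum Re (quad_form ((\<psi> ^^ t) Z) x)) ({1..k} \<rightarrow>\<^sub>E UNIV)" for t
    using Suc.IH[of "(\<psi> ^^ t) Z"] Suc.prems pos[of t] unfolding comm c_def by simp
  have "((\<lambda>(t, s). real ((t + q) choose q) * (c k s * Re (quad_form (comp_powers \<phi> s k ((\<psi> ^^ t) Y)) x)))
      has_sum Re (quad_form X x)) (UNIV \<times> ({1..k} \<rightarrow>\<^sub>E UNIV))"
  proof (rule has_sum_Sigma_nonneg)
    show "((\<lambda>t. real ((t + q) choose q) * Re (quad_form ((\<psi> ^^ t) Z) x))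
        has_sum Re (quad_form X x)) UNIV"
      using has_sum_defect_power[OF \<psi>] \<open>positive_op Z\<close> unfolding Z_def by blast
    show "0 \<le> (case (t, s) of (t, s) \<Rightarrow> real ((t + q) choose q)
        * (c k s * Re (quad_form (comp_powers \<phi> s k ((\<psi> ^^ t) Y)) x)))" for t s
    proof -
      have "0 \<le> c k s"
        unfolding c_def by (rule of_nat_0_le_iff)
      then show ?thesis
        using Suc.prems(2) pos[of t]
        by (auto intro!: mult_nonneg_nonneg Re_quad_form_nonneg positive_op_comp_powers)
    qed
  qed (use inner in \<open>auto intro!: has_sum_cmult_right\<close>)
  \<comment> \<open>Absorbs \<open>t\<close> into the multi-index as coordinate
    \<open>Suc k\<close>; the factors for \<open>{1..k}\<close> do not see this update.\<close>
  also have "?this \<longleftrightarrow>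
      ((\<lambda>(t, s). (\<lambda>s. c (Suc k) s * Re (quad_form (comp_powers \<phi> s (Suc k) Y) x)) (s(Suc k := t)))
      has_sum Re (quad_form X x)) (UNIV \<times> ({1..k} \<rightarrow>\<^sub>E UNIV))"
  proof (rule has_sum_cong, clarify)
    fix t and s :: "nat \<Rightarrow> nat"
    have "c k (s(Suc k := t)) = c k s"
      unfolding c_def by (intro arg_cong[of _ _ real] prod.cong) auto
    then have "c (Suc k) (s(Suc k := t)) = real ((t + q) choose q) * c k s"
      by (simp add: c_def q mult.commute)
    moreover have "comp_powers \<phi> (s(Suc k := t)) (Suc k) Y = comp_powers \<phi> s k ((\<psi> ^^ t) Y)"
      by (simp add: comp_powers_Suc \<psi>_def) (rule comp_powers_cong, simp)
    ultimately show "real ((t + q) choose q) * (c k s * Re (quad_form (comp_powers \<phi> s k ((\<psi> ^^ t) Y)) x))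
      = c (Suc k) (s(Suc k := t)) * Re (quad_form (comp_powers \<phi> (s(Suc k := t)) (Suc k) Y) x)"
      by simp
  qed
  finally show ?case
    unfolding Y c_def has_sum_PiE_Suc .
qed

lemma positive_op_quad_form: "positive_op T \<Longrightarrow> quad_form T x = of_real (Re (quad_form T x))"
  by (simp add: positive_op_iff complex_nonneg_Reals_iff complex_eq_iff)

theorem theorem1p2:
  fixes \<phi> :: "nat \<Rightarrow> 'a::complex_hilbert bop \<Rightarrow> 'a bop" and m :: "nat \<Rightarrow> nat" and k :: nat
  assumes "separable TYPE('a)"
    and "k \<ge> 1"
    and "\<And>i. i \<in> {1..k} \<Longrightarrow> m i \<ge> 1"
    and "\<And>i. i \<in> {1..k} \<Longrightarrow> positive_linear_map (\<phi> i)"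
    and "\<And>i. i \<in> {1..k} \<Longrightarrow> pure_map (\<phi> i)"
  shows "inj (Delta \<phi> m k)
    \<and> (\<forall>X. Lambda_iter_dom \<phi> m k (Delta \<phi> m k X) \<and> X = Lambda_iter \<phi> m k (Delta \<phi> m k X))
    \<and> ((\<forall>i\<in>{1..k}. \<forall>j\<in>{1..k}. \<phi> i \<circ> \<phi> j = \<phi> j \<circ> \<phi> i) \<longrightarrow>
        (\<forall>X. positive_op (Delta \<phi> m k X) \<longrightarrow>
          wot_has_sum
            (\<lambda>s. of_nat (\<Prod>i=1..k. (s i + m i - 1) choose (m i - 1)) *\<^sub>C
                   comp_powers \<phi> s k (Delta \<phi> m k X))
            X ({1..k} \<rightarrow>\<^sub>E UNIV)))"
proof (intro conjI allI impI)
  note inverse = Lambda_iter_Delta[of k \<phi>, OF assms(4,5)]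
  show "inj (Delta \<phi> m k)"
    \<comment> \<open>\<open>Lambda_iter \<phi> m k\<close> is a left inverse.\<close>
    by (rule injI) (metis inverse)
  fix X
  show "Lambda_iter_dom \<phi> m k (Delta \<phi> m k X)" "X = Lambda_iter \<phi> m k (Delta \<phi> m k X)"
    using inverse[of m X] by simp_all
next
  fix X
  assume comm: "\<forall>i\<in>{1..k}. \<forall>j\<in>{1..k}. \<phi> i \<circ> \<phi> j = \<phi> j \<circ> \<phi> i"
    and pos: "positive_op (Delta \<phi> m k X)"
  define c where "c s = (\<Prod>i=1..k. (s i + m i - 1) choose (m i - 1))" for s :: "nat \<Rightarrow> nat"
  define Y where "Y s = comp_powers \<phi> s k (Delta \<phi> m k X)" for s
  have "positive_op X" "\<And>s. positive_op (Y s)"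
    unfolding Y_def using positive_op_Delta_imp positive_op_comp_powers assms(4,5) pos by metis+
  \<comment> \<open>Positive operators have real quadratic forms, so the real sums lift to complex
    ones.\<close>
  note of_real = this[THEN positive_op_quad_form]
  have "((\<lambda>s. of_nat (c s) * quad_form (Y s) x) has_sum quad_form X x) ({1..k} \<rightarrow>\<^sub>E UNIV)" for x
  proof -
    have "((\<lambda>s. real (c s) * Re (quad_form (Y s) x)) has_sum Re (quad_form X x)) ({1..k} \<rightarrow>\<^sub>E UNIV)"
      unfolding c_def Y_def using comm assms(3,4,5) pos
      by (intro has_sum_comp_powers) (auto dest: fun_cong simp: fun_eq_iff)
    then have "((\<lambda>s. complex_of_real (real (c s) * Re (quad_form (Y s) x)))
        has_sum of_real (Re (quad_form X x))) ({1..k} \<rightarrow>\<^sub>E UNIV)"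
      by (rule has_sum_of_real)
    then show ?thesis
      unfolding of_real_mult of_real_of_nat_eq of_real[symmetric] .
  qed
  \<comment> \<open>Both \<open>has_sum\<close> and \<open>wot_has_sum\<close> are limits along
    finite subsets, so the sums of quadratic forms give weak convergence.\<close>
  then show "wot_has_sum (\<lambda>s. of_nat (\<Prod>i=1..k. (s i + m i - 1) choose (m i - 1)) *\<^sub>C
      comp_powers \<phi> s k (Delta \<phi> m k X)) X ({1..k} \<rightarrow>\<^sub>E UNIV)"
    unfolding c_def Y_def
    by (simp add: wot_has_sum_def wot_tendsto_iff_quad_form has_sum_def quad_form_sum)
qed

end
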